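(* Let $n$ and $\alpha$ be positive integers. If $G$ is a connected graph of order $n$ with independence number $\alpha$, then $$ABS(G)\leq \alpha(n-\alpha)\sqrt{\frac{2n-\alpha-3}{2n-\alpha-1}}+\frac{1}{2}(n-\alpha)(n-\alpha-1)\sqrt{\frac{n-2}{n-1}},$$ with equality if and only if $G\cong N_{\alpha}+K_{n-\alpha}$.
   Context: All graphs are finite and simple. For a graph $G$ with vertex degrees $d_v$, the atom-bond sum-connectivity index is $ABS(G)=\sum_{uv\in E(G)}\left(\frac{d_u+d_v-2}{d_u+d_v}\right)^{1/2}$. The independence number is the maximum cardinality of a set of pairwise non-adjacent vertices. $N_\alpha$ is the edgeless graph on $\alpha$ vertices, $K_m$ is the complete graph on $m$ vertices, and $N_\alpha+K_{n-\alpha}$ is their join (the disjoint union together with all edges between $N_\alpha$ and $K_{n-\alpha}$). In the displayed bound, any term whose integer coefficient is $0$ is read as $0$ (this matters only for $n=1$). *)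

theory Defs
  imports Complex_Main "Graph_Theory.Graph_Theory"
begin

text \<open>
  A finite simple graph is a \<open>pair_graph\<close>: an undirected edge \<open>uv\<close> is the pair of opposite arcs
  \<open>(u, v)\<close> and \<open>(v, u)\<close>.
\<close>

definition edges :: "'a pair_pre_digraph \<Rightarrow> 'a set set" where
  "edges G = {{u, v} | u v. (u, v) \<in> parcs G}"

text \<open>In a symmetric digraph the out-degree is the number of neighbours.\<close>

definition degree :: "'a pair_pre_digraph \<Rightarrow> 'a \<Rightarrow> nat" where
  "degree G v = out_degree (with_proj G) v"

text \<open>
  For an edge \<open>e = {u, v}\<close> of a loop-free graph, \<open>\<Sum>w\<in>e. degree G w\<close> is \<open>d\<^sub>u + d\<^sub>v\<close>.
\<close>

definition ABS :: "'a pair_pre_digraph \<Rightarrow> real" where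
  "ABS G = (\<Sum>e\<in>edges G. sqrt ((real (\<Sum>w\<in>e. degree G w) - 2) / real (\<Sum>w\<in>e. degree G w)))"

definition independent_set :: "'a pair_pre_digraph \<Rightarrow> 'a set \<Rightarrow> bool" where
  "independent_set G S \<longleftrightarrow> S \<subseteq> pverts G \<and> (\<forall>u\<in>S. \<forall>v\<in>S. u \<noteq> v \<longrightarrow> (u, v) \<notin> parcs G)"

definition independence_number :: "'a pair_pre_digraph \<Rightarrow> nat" where
  "independence_number G = Max {card S | S. independent_set G S}"

definition edgeless_graph :: "nat \<Rightarrow> nat pair_pre_digraph" where
  "edgeless_graph k = \<lparr>pverts = {..<k}, parcs = {}\<rparr>"

definition complete_graph :: "nat \<Rightarrow> nat pair_pre_digraph" where
  "complete_graph m = \<lparr>pverts = {..<m}, parcs = {(u, v). u < m \<and> v < m \<and> u \<noteq> v}\<rparr>"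

definition graph_join ::
    "'a pair_pre_digraph \<Rightarrow> 'b pair_pre_digraph \<Rightarrow> ('a + 'b) pair_pre_digraph" where
  "graph_join G H =
    \<lparr>pverts = pverts G <+> pverts H,
     parcs = {(Inl u, Inl v) | u v. (u, v) \<in> parcs G}
       \<union> {(Inr u, Inr v) | u v. (u, v) \<in> parcs H}
       \<union> {(Inl u, Inr v) | u v. u \<in> pverts G \<and> v \<in> pverts H}
       \<union> {(Inr v, Inl u) | u v. u \<in> pverts G \<and> v \<in> pverts H}\<rparr>"

lemma pair_graph_edgeless_graph: "pair_graph (edgeless_graph k)"
  by unfold_locales (auto simp: edgeless_graph_def symmetric_def sym_def)

lemma complete_digraph_complete_graph: "complete_digraph m (with_proj (complete_graph m))"
  unfolding complete_digraph_pair_def by (auto simp: complete_graph_def)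

lemma pair_graph_complete_graph: "pair_graph (complete_graph m)"
  using complete_digraph_complete_graph pair_graphI_graph
  unfolding complete_digraph_def by blast

lemma pair_graph_graph_join:
  assumes "pair_graph G" "pair_graph H"
  shows "pair_graph (graph_join G H)"
proof -
  interpret G: pair_graph G by fact
  interpret H: pair_graph H by fact
  have wf: "parcs (graph_join G H) \<subseteq> pverts (graph_join G H) \<times> pverts (graph_join G H)"
    by (auto simp: graph_join_def dest: G.wellformed' H.wellformed')
  have fin: "finite (pverts (graph_join G H))"
    using G.finite_verts H.finite_verts by (simp add: graph_join_def)
  show ?thesis
  proof
    show "finite (parcs (graph_join G H))"
      using wf fin by (meson finite_SigmaI finite_subset)
    show "symmetric (with_proj (graph_join G H))"
      by (auto simp: symmetric_def sym_def graph_join_def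
          intro: G.arcs_symmetric H.arcs_symmetric)
    show "fst e \<noteq> snd e" if "e \<in> parcs (graph_join G H)" for e
      using that by (auto simp: graph_join_def dest: G.no_loops' H.no_loops')
  qed (use wf fin in auto)
qed

end

theory Submission
  imports Defs
begin

text \<open>
  Adding edges never decreases \<open>ABS\<close>, because \<open>sqrt ((s - 2) / s)\<close> is nonnegative and increasing
  in the degree sum \<open>s \<ge> 2\<close>, and adding an edge of degree sum greater than 2 strictly increases it.
  If \<open>S\<close> is a maximum independent set of \<open>G\<close>, then \<open>G\<close> is a spanning subgraph of the graph that
  has all edges except those inside \<open>S\<close>, which is a copy of the join and whose \<open>ABS\<close> is the bound.
  Since isomorphic graphs have equally many arcs, \<open>G\<close> is isomorphic to the join only if it has all
  these edges.
\<close>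

section \<open>Edge weights, degrees and edges\<close>

definition edge_weight :: "real \<Rightarrow> real" where
  "edge_weight s = sqrt ((s - 2) / s)"

text \<open>The quotient is 1 - 2/s, which increases on positive s. Below 2 it is negative, but
  \<open>sqrt\<close> in HOL is monotone on all reals.\<close>

lemma edge_weight_mono:
  assumes "0 < s" "s \<le> t"
  shows "edge_weight s \<le> edge_weight t"
proof -
  have "(s - 2) / s \<le> (t - 2) / t"
    using assms by (simp add: field_simps)
  then show ?thesis
    by (simp add: edge_weight_def)
qed

lemma edge_weight_nonneg: "2 \<le> s \<Longrightarrow> 0 \<le> edge_weight s"
  by (simp add: edge_weight_def)

lemma edge_weight_pos: "2 < s \<Longrightarrow> 0 < edge_weight s"
  by (simp add: edge_weight_def)

lemma ABS_edge_weight: "ABS G = (\<Sum>e\<in>edges G. edge_weight (real (\<Sum>w\<in>e. degree G w)))"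
  by (simp add: ABS_def edge_weight_def)

lemma degree_eq_card: "degree G v = card {w. (v, w) \<in> parcs G}"
proof -
  have "out_arcs (with_proj G) v = Pair v ` {w. (v, w) \<in> parcs G}"
    by (auto simp: out_arcs_def)
  then show ?thesis
    by (simp add: degree_def out_degree_def card_image inj_on_def)
qed

lemma edgesI: "(u, v) \<in> parcs G \<Longrightarrow> {u, v} \<in> edges G"
  by (auto simp: edges_def)

context pair_graph
begin

lemma finite_neighbours: "finite {w. (v, w) \<in> parcs G}"
  by (rule finite_subset[of _ "pverts G"]) (auto dest: wellformed')

lemma finite_edges: "finite (edges G)"
  by (rule finite_subset[of _ "Pow (pverts G)"]) (auto simp: edges_def dest: wellformed')

text \<open>Symmetry gives both orientations, and the absence of loops gives two distinct endpoints,
  so that the sum over the set \<open>e\<close> really has two terms.\<close>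

lemma edgesE:
  assumes "e \<in> edges G"
  obtains u v where "e = {u, v}" "u \<noteq> v" "(u, v) \<in> parcs G" "(v, u) \<in> parcs G"
    "(\<Sum>w\<in>e. degree G w) = degree G u + degree G v"
proof -
  obtain u v where "e = {u, v}" "(u, v) \<in> parcs G"
    using assms by (auto simp: edges_def)
  moreover from this have "u \<noteq> v" "(v, u) \<in> parcs G"
    by (auto dest: no_loops' arcs_symmetric)
  ultimately show ?thesis
    using that by simp
qed

lemma degree_pos: "(u, v) \<in> parcs G \<Longrightarrow> 0 < degree G u"
  using finite_neighbours by (auto simp: degree_eq_card card_gt_0_iff)

lemma degree_sum_ge_2:
  assumes "e \<in> edges G"
  shows "2 \<le> (\<Sum>w\<in>e. degree G w)"
proof -
  obtain u v where "(u, v) \<in> parcs G" "(v, u) \<in> parcs G"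
    and sum: "(\<Sum>w\<in>e. degree G w) = degree G u + degree G v"
    using assms by (rule edgesE)
  then have "0 < degree G u" "0 < degree G v"
    by (blast intro: degree_pos)+
  then show ?thesis
    unfolding sum by linarith
qed

text \<open>\<open>ABS\<close> sums over edges while subgraphs are compared by arcs; this translates
  between the two. An edge fixes its arc only up to orientation, and \<open>H\<close> contains both
  orientations.\<close>

lemma edges_mono_iff:
  assumes "pair_graph H"
  shows "edges G \<subseteq> edges H \<longleftrightarrow> parcs G \<subseteq> parcs H"
proof
  interpret H: pair_graph H by fact
  assume *: "edges G \<subseteq> edges H"
  have "(u, v) \<in> parcs H" if "(u, v) \<in> parcs G" for u v
  proof -
    have "{u, v} \<in> edges H"
      using edgesI[OF that] * by (rule rev_subsetD)
    then obtain a b where "{u, v} = {a, b}" "(a, b) \<in> parcs H" "(b, a) \<in> parcs H"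
      by (rule H.edgesE)
    then show ?thesis
      unfolding doubleton_eq_iff by blast
  qed
  then show "parcs G \<subseteq> parcs H"
    by (rule subrelI)
next
  assume "parcs G \<subseteq> parcs H"
  then show "edges G \<subseteq> edges H"
    unfolding edges_def by blast
qed

end

section \<open>Monotonicity of \<open>ABS\<close> under adding edges\<close>

lemma ABS_mono:
  assumes "pair_graph G" "pair_graph H" and sub: "parcs G \<subseteq> parcs H"
  shows "ABS G \<le> ABS H"
    and "\<lbrakk>ABS G = ABS H; \<forall>e\<in>edges H. 2 < (\<Sum>w\<in>e. degree H w)\<rbrakk> \<Longrightarrow> parcs G = parcs H"
proof -
  interpret G: pair_graph G by fact
  interpret H: pair_graph H by fact
  \<comment> \<open>Weighting the edges of \<open>G\<close> by the degrees of \<open>H\<close> gives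
    a sum between \<open>ABS G\<close> and \<open>ABS H\<close>: the degrees grow first, then the
    edges are added.\<close>
  let ?w = "\<lambda>e. edge_weight (real (\<Sum>w\<in>e. degree H w))"
  have E: "edges G \<subseteq> edges H"
    using sub G.edges_mono_iff[OF assms(2)] by blast
  have deg: "degree G v \<le> degree H v" for v
    unfolding degree_eq_card using sub by (intro card_mono H.finite_neighbours) auto
  have "edge_weight (real (\<Sum>w\<in>e. degree G w)) \<le> ?w e" if "e \<in> edges G" for e
  proof (rule edge_weight_mono)
    show "0 < real (\<Sum>w\<in>e. degree G w)"
      using G.degree_sum_ge_2[OF that] by linarith
    show "real (\<Sum>w\<in>e. degree G w) \<le> real (\<Sum>w\<in>e. degree H w)"
      using deg by (simp only: of_nat_le_iff sum_mono)
  qed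
  then have 1: "ABS G \<le> sum ?w (edges G)"
    unfolding ABS_edge_weight by (rule sum_mono)
  have nonneg: "0 \<le> ?w e" if "e \<in> edges H" for e
    using H.degree_sum_ge_2[OF that] by (intro edge_weight_nonneg) linarith
  then have 2: "sum ?w (edges G) \<le> ABS H"
    unfolding ABS_edge_weight using E by (intro sum_mono2 H.finite_edges) auto
  from 1 2 show "ABS G \<le> ABS H"
    by (rule order_trans)
  assume eq: "ABS G = ABS H" and gt: "\<forall>e\<in>edges H. 2 < (\<Sum>w\<in>e. degree H w)"
  have "edges H \<subseteq> edges G"
  proof (rule ccontr)
    assume "\<not> edges H \<subseteq> edges G"
    then obtain e where e: "e \<in> edges H" "e \<notin> edges G"
      by blast
    \<comment> \<open>A degree sum of exactly 2 has weight 0, so such an edge could be added without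
      changing \<open>ABS\<close>; the premise \<open>gt\<close> excludes this.\<close>
    have "2 < real (\<Sum>w\<in>e. degree H w)"
      using gt e(1) by (metis of_nat_less_iff of_nat_numeral)
    then have "sum ?w (edges G) < sum ?w (edges H)"
      using E e nonneg by (intro sum_strict_mono2[OF H.finite_edges _ _ edge_weight_pos]) auto
    with 1 eq show False
      by (simp add: ABS_edge_weight)
  qed
  then show "parcs G = parcs H"
    using sub H.edges_mono_iff[OF assms(1)] by blast
qed

section \<open>The extremal graph on the vertices of \<open>G\<close>\<close>

definition split_graph :: "'a set \<Rightarrow> 'a set \<Rightarrow> 'a pair_pre_digraph" where
  "split_graph S T = \<lparr>pverts = S \<union> T,
     parcs = {(u, v). u \<in> S \<union> T \<and> v \<in> S \<union> T \<and> u \<noteq> v \<and> (u \<in> T \<or> v \<in> T)}\<rparr>"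

lemma split_graph_simps [simp]:
  "pverts (split_graph S T) = S \<union> T"
  "(u, v) \<in> parcs (split_graph S T) \<longleftrightarrow>
     u \<in> S \<union> T \<and> v \<in> S \<union> T \<and> u \<noteq> v \<and> (u \<in> T \<or> v \<in> T)"
  by (auto simp: split_graph_def)

lemma pair_graph_split_graph:
  assumes "finite S" "finite T"
  shows "pair_graph (split_graph S T)"
proof
  have "parcs (split_graph S T) \<subseteq> (S \<union> T) \<times> (S \<union> T)"
    by auto
  then show "finite (parcs (split_graph S T))"
    using assms by (meson finite_SigmaI finite_UnI finite_subset)
  show "symmetric (with_proj (split_graph S T))"
    by (auto simp: symmetric_def sym_def)
qed (use assms in auto)

text \<open>Independence forces each arc to have an end outside \<open>S\<close>. Since
  \<open>split_graph\<close> keeps the vertices of \<open>G\<close>, this is a literal inclusion of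
  arc sets, not an embedding into the sum type of the join.\<close>

lemma parcs_subset_split_graph:
  assumes "pair_graph G" "independent_set G S"
  shows "parcs G \<subseteq> parcs (split_graph S (pverts G - S))"
proof -
  interpret pair_graph G by fact
  have "(u, v) \<in> parcs (split_graph S (pverts G - S))" if "(u, v) \<in> parcs G" for u v
    using assms(2) that wellformed'[OF that] no_loops'[OF that]
    by (auto simp: independent_set_def)
  then show ?thesis
    by auto
qed

lemma degree_split_graph:
  assumes "finite S" "finite T" "S \<inter> T = {}"
  shows "u \<in> S \<Longrightarrow> degree (split_graph S T) u = card T"
    and "u \<in> T \<Longrightarrow> degree (split_graph S T) u = card S + card T - 1"
proof -
  assume "u \<in> S"
  then have "{w. (u, w) \<in> parcs (split_graph S T)} = T"
    using assms(3) by auto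
  then show "degree (split_graph S T) u = card T"
    by (simp add: degree_eq_card)
next
  assume "u \<in> T"
  then have "{w. (u, w) \<in> parcs (split_graph S T)} = (S \<union> T) - {u}"
    by auto
  then show "degree (split_graph S T) u = card S + card T - 1"
    using \<open>u \<in> T\<close> assms by (simp add: degree_eq_card card_Un_disjoint)
qed

text \<open>These are the two classes of edges on which the degree sum is constant, as needed to
  evaluate \<open>ABS\<close>.\<close>

lemma edges_split_graph:
  assumes "S \<inter> T = {}"
  shows "edges (split_graph S T) =
    (\<lambda>(u, v). {u, v}) ` (S \<times> T) \<union> {e. e \<subseteq> T \<and> card e = 2}"
proof (intro equalityI subsetI)
  show "e \<in> edges (split_graph S T)"
    if "e \<in> (\<lambda>(u, v). {u, v}) ` (S \<times> T) \<union> {e. e \<subseteq> T \<and> card e = 2}" for e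
    using that
  proof
    assume "e \<in> (\<lambda>(u, v). {u, v}) ` (S \<times> T)"
    then obtain u v where "e = {u, v}" "u \<in> S" "v \<in> T"
      by auto
    moreover from this assms have "(u, v) \<in> parcs (split_graph S T)"
      by auto
    ultimately show ?thesis
      by (simp add: edgesI)
  next
    assume "e \<in> {e. e \<subseteq> T \<and> card e = 2}"
    then obtain u v where "e = {u, v}" "u \<noteq> v" "u \<in> T" "v \<in> T"
      by (auto simp: card_2_iff)
    moreover from this have "(u, v) \<in> parcs (split_graph S T)"
      by auto
    ultimately show ?thesis
      by (simp add: edgesI)
  qed
next
  show "e \<in> (\<lambda>(u, v). {u, v}) ` (S \<times> T) \<union> {e. e \<subseteq> T \<and> card e = 2}"
    if edge: "e \<in> edges (split_graph S T)" for e
  proof -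
    obtain u v where "e = {u, v}" "(u, v) \<in> parcs (split_graph S T)"
      using edge unfolding edges_def by blast
    then have e: "e = {u, v}" "u \<in> S \<union> T" "v \<in> S \<union> T" "u \<noteq> v" "u \<in> T \<or> v \<in> T"
      by simp_all
    have image: "{a, b} \<in> (\<lambda>(u, v). {u, v}) ` (S \<times> T)" if "a \<in> S" "b \<in> T" for a b
      using that by (intro image_eqI[of _ _ "(a, b)"]) auto
    consider "u \<in> S" "v \<in> T" | "v \<in> S" "u \<in> T" | "u \<in> T" "v \<in> T"
      using e(2,3,5) by blast
    then show ?thesis
    proof cases
      case 1
      then show ?thesis
        using image e(1) by blast
    next
      \<comment> \<open>The edge is traversed from \<open>T\<close> to \<open>S\<close>; it is
        reversed to match the orientation of \<open>S \<times> T\<close>.\<close>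
      case 2
      then have "{v, u} \<in> (\<lambda>(u, v). {u, v}) ` (S \<times> T)"
        by (rule image)
      then show ?thesis
        unfolding e(1) by (simp only: insert_commute[of u v] Un_iff simp_thms)
    next
      case 3
      then show ?thesis
        using e(1,4) by simp
    qed
  qed
qed

text \<open>A vertex of \<open>S\<close> has degree |T| and a vertex of \<open>T\<close> has degree
  n - 1. This gives the degree sum of the cross edges and of the edges inside
  \<open>T\<close>.\<close>

lemma ABS_split_graph:
  assumes fin: "finite S" "finite T" and disj: "S \<inter> T = {}"
  defines "n \<equiv> card S + card T"
  shows "ABS (split_graph S T) =
    real (card S * card T) * edge_weight (real (card T + (n - 1)))
      + real (card T choose 2) * edge_weight (real (2 * (n - 1)))"
proof -
  let ?H = "split_graph S T" and ?A = "(\<lambda>(u, v). {u, v}) ` (S \<times> T)"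
  let ?B = "{e. e \<subseteq> T \<and> card e = 2}"
  let ?w = "\<lambda>e. edge_weight (real (\<Sum>w\<in>e. degree ?H w))"
  note deg = degree_split_graph[OF fin disj]
  \<comment> \<open>By disjointness an unordered cross edge determines which end lies in
    \<open>S\<close>, so cross edges are counted by \<open>S \<times> T\<close>.\<close>
  have inj: "inj_on (\<lambda>(u, v). {u, v}) (S \<times> T)"
    using disj by (auto simp: inj_on_def doubleton_eq_iff)
  have finB: "finite ?B"
    by (rule finite_subset[of _ "Pow T"]) (use fin in auto)
  have "ABS ?H = sum ?w ?A + sum ?w ?B"
    unfolding ABS_edge_weight edges_split_graph[OF disj]
    by (rule sum.union_disjoint) (use fin finB disj in auto)
  also have "sum ?w ?A = (\<Sum>x\<in>S \<times> T. edge_weight (real (card T + (n - 1))))"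
    unfolding sum.reindex[OF inj]
  proof (rule sum.cong[OF refl])
    fix x assume "x \<in> S \<times> T"
    then obtain u v where x: "x = (u, v)" "u \<in> S" "v \<in> T"
      by auto
    moreover have "u \<noteq> v"
      using x disj by auto
    ultimately have "(\<Sum>w\<in>{u, v}. degree ?H w) = card T + (n - 1)"
      using deg by (simp add: n_def)
    then show "(?w \<circ> (\<lambda>(u, v). {u, v})) x = edge_weight (real (card T + (n - 1)))"
      unfolding x(1) by (simp only: o_apply prod.case)
  qed
  also have "\<dots> = real (card S * card T) * edge_weight (real (card T + (n - 1)))"
    by (simp add: card_cartesian_product)
  also have "sum ?w ?B = (\<Sum>e\<in>?B. edge_weight (real (2 * (n - 1))))"
  proof (rule sum.cong[OF refl])
    fix e assume "e \<in> ?B"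
    then obtain u v where "e = {u, v}" "u \<noteq> v" "u \<in> T" "v \<in> T"
      by (auto simp: card_2_iff)
    then have "(\<Sum>w\<in>e. degree ?H w) = 2 * (n - 1)"
      using deg(2) by (simp add: n_def)
    then show "?w e = edge_weight (real (2 * (n - 1)))"
      by (simp only:)
  qed
  also have "\<dots> = real (card T choose 2) * edge_weight (real (2 * (n - 1)))"
    by (simp add: n_subsets[OF fin(2)])
  finally show ?thesis .
qed

text \<open>One end lies in \<open>T\<close> and has degree n - 1, which is at least 2; the other
  end has degree at least 1. This is the strictness premise of \<open>ABS_mono(2)\<close>.\<close>

lemma degree_sum_split_graph_gt_2:
  assumes fin: "finite S" "finite T" and disj: "S \<inter> T = {}" and "card S + card T \<ge> 3"
    and e: "e \<in> edges (split_graph S T)"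
  shows "2 < (\<Sum>w\<in>e. degree (split_graph S T) w)"
proof -
  interpret pair_graph "split_graph S T"
    by (rule pair_graph_split_graph[OF fin])
  note deg = degree_split_graph[OF fin disj]
  obtain u v where uv: "(u, v) \<in> parcs (split_graph S T)" "(v, u) \<in> parcs (split_graph S T)"
    and sum: "(\<Sum>w\<in>e. degree (split_graph S T) w)
      = degree (split_graph S T) u + degree (split_graph S T) v"
    using e by (rule edgesE)
  have "2 \<le> degree (split_graph S T) u \<or> 2 \<le> degree (split_graph S T) v"
    using uv(1) deg(2) assms(4) by auto
  moreover have "0 < degree (split_graph S T) u" "0 < degree (split_graph S T) v"
    using uv degree_pos by auto
  ultimately show ?thesis
    using sum by linarith
qed

section \<open>Isomorphisms and the join\<close>

lemma card_parcs_digraph_iso: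
  assumes "digraph_iso (with_proj G) (with_proj H)"
  shows "card (parcs G) = card (parcs H)"
proof -
  obtain f where f: "pre_digraph.digraph_isomorphism (with_proj G) f"
    and H: "with_proj H = app_iso f (with_proj G)"
    using assms by (auto simp: digraph_iso_def)
  have "parcs H = iso_arcs f ` parcs G"
    using arg_cong[OF H, of arcs] by simp
  then show ?thesis
    using pre_digraph.digraph_isomorphism_inj_on_arcs[OF f] by (simp add: card_image)
qed

lemma digraph_iso_with_projI:
  assumes "pair_graph G" and bij: "bij_betw f (pverts G) (pverts H)"
    and parcs: "parcs H = map_prod f f ` parcs G"
  shows "digraph_iso (with_proj G) (with_proj H)"
proof -
  interpret pair_graph G by fact
  \<comment> \<open>An isomorphism record also carries an arc map and the new head and tail
    functions. As arcs are pairs, \<open>f\<close> induces the arc map, and head and tail remain the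
    projections.\<close>
  let ?h = "\<lparr>iso_verts = f, iso_arcs = map_prod f f, iso_head = snd, iso_tail = fst\<rparr>"
  have inj: "inj_on f (pverts G)"
    using bij by (simp add: bij_betw_def)
  have "inj_on (map_prod f f) (parcs G)"
    by (rule inj_on_subset[OF map_prod_inj_on[OF inj inj]]) (auto dest: wellformed')
  then have "pre_digraph.digraph_isomorphism (with_proj G) ?h"
    using inj by (simp add: pre_digraph.digraph_isomorphism_def wf_digraph_axioms)
  moreover have "with_proj H = app_iso ?h (with_proj G)"
    using bij parcs by (simp add: app_iso_def with_proj_def bij_betw_def)
  ultimately show ?thesis
    unfolding digraph_iso_def by blast
qed

text \<open>\<open>S\<close> and \<open>T\<close> are numbered separately, and the numbers are
  tagged with \<open>Inl\<close> and \<open>Inr\<close> to match the vertices of the join.\<close>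

lemma digraph_iso_split_graph_join:
  assumes fin: "finite S" "finite T" and disj: "S \<inter> T = {}"
  shows "digraph_iso (with_proj (split_graph S T))
    (with_proj (graph_join (edgeless_graph (card S)) (complete_graph (card T))))"
proof -
  obtain g h where g: "bij_betw g S {..<card S}" and h: "bij_betw h T {..<card T}"
    using fin by (metis ex_bij_betw_finite_nat lessThan_atLeast0)
  define f where "f x = (if x \<in> S then Inl (g x) else Inr (h x))" for x
  have gS: "g ` S = {..<card S}" and hT: "h ` T = {..<card T}"
    using g h by (auto simp: bij_betw_def)
  have fS: "f x = Inl (g x)" if "x \<in> S" for x
    using that by (simp add: f_def)
  have fT: "f x = Inr (h x)" if "x \<in> T" for x
    using that disj by (auto simp: f_def)
  have image: "f ` S = Inl ` {..<card S}" "f ` T = Inr ` {..<card T}"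
    unfolding gS[symmetric] hT[symmetric] image_image by (auto simp: fS fT intro: rev_image_eqI)
  have inj: "inj_on f (S \<union> T)"
    using g h by (auto simp: bij_betw_def f_def inj_on_def)
  show ?thesis
  proof (rule digraph_iso_with_projI[OF pair_graph_split_graph[OF fin]])
    let ?J = "graph_join (edgeless_graph (card S)) (complete_graph (card T))"
    show "bij_betw f (pverts (split_graph S T)) (pverts ?J)"
      using inj image by (auto simp: bij_betw_def graph_join_def edgeless_graph_def
          complete_graph_def Plus_def image_Un)
    \<comment> \<open>Written through images under \<open>f\<close>, the arcs of the join have the
      same shape as those of the split graph, and injectivity of \<open>f\<close> does the
      rest.\<close>
    have J: "parcs ?J = {(x, y). x \<in> f ` (S \<union> T) \<and> y \<in> f ` (S \<union> T) \<and> x \<noteq> y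
        \<and> (x \<in> f ` T \<or> y \<in> f ` T)}"
      unfolding image_Un image
      by (auto simp: graph_join_def edgeless_graph_def complete_graph_def)
    show "parcs ?J = map_prod f f ` parcs (split_graph S T)"
    proof (intro set_eqI iffI)
      fix p assume "p \<in> parcs ?J"
      then obtain u v where "p = (f u, f v)" "u \<in> S \<union> T" "v \<in> S \<union> T" "f u \<noteq> f v"
        "f u \<in> f ` T \<or> f v \<in> f ` T"
        unfolding J by blast
      moreover from this have "u \<in> T \<or> v \<in> T"
        using inj by (auto simp: inj_on_image_mem_iff[OF inj])
      ultimately have "(u, v) \<in> parcs (split_graph S T)" "p = map_prod f f (u, v)"
        by auto
      then show "p \<in> map_prod f f ` parcs (split_graph S T)"
        by (rule rev_image_eqI)
    next
      fix p assume "p \<in> map_prod f f ` parcs (split_graph S T)"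
      then show "p \<in> parcs ?J"
        unfolding J using inj by (auto dest: inj_onD)
    qed
  qed
qed

section \<open>Maximum independent sets and connectedness\<close>

lemma independence_number_witness:
  assumes "pair_graph G"
  obtains S where "independent_set G S" "card S = independence_number G"
proof -
  interpret pair_graph G by fact
  let ?C = "{card S | S. independent_set G S}"
  have "?C \<subseteq> card ` Pow (pverts G)"
    by (auto simp: independent_set_def)
  then have "finite ?C"
    by (rule finite_subset) simp
  \<comment> \<open>The empty set makes \<open>?C\<close> nonempty, so that \<open>Max\<close> is
    attained.\<close>
  moreover have "independent_set G {}"
    by (simp add: independent_set_def)
  ultimately have "Max ?C \<in> ?C"
    by (intro Max_in) auto
  then show ?thesis
    using that by (auto simp: independence_number_def)
qed

text \<open>This serves the equality case on two vertices, where the only possible edge has weight 0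
  and \<open>ABS\<close> cannot detect it. Without arcs a vertex reaches only itself.\<close>

lemma connected_has_arc:
  assumes "pair_graph G" "Digraph_Component.connected (with_proj G)" "2 \<le> card (pverts G)"
  shows "parcs G \<noteq> {}"
proof
  assume empty: "parcs G = {}"
  obtain u v where uv: "u \<in> pverts G" "v \<in> pverts G" "u \<noteq> v"
    using assms(3) by (metis card_2_iff' obtain_subset_with_card_n subsetD)
  have "u \<rightarrow>\<^sup>*\<^bsub>with_proj (mk_symmetric (with_proj G))\<^esub> v"
    using assms(2) uv by (auto simp: Digraph_Component.connected_def strongly_connected_def mk_symmetric_def)
  then have "(u, v) \<in> rtrancl_on (pverts G) {}"
    using empty by (simp add: reachable_def mk_symmetric_def)
  then show False
    using uv(3) by (cases rule: rtrancl_on.cases) auto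
qed

section \<open>The bound and its equality case\<close>

theorem theorem4:
  fixes G :: "'a pair_pre_digraph" and n \<alpha> :: nat
  assumes "n > 0" and "\<alpha> > 0"
    and "pair_graph G"
    and "Digraph_Component.connected (with_proj G)"
    and "card (pverts G) = n"
    and "independence_number G = \<alpha>"
  defines "bound \<equiv>
      real \<alpha> * (real n - real \<alpha>)
        * sqrt ((2 * real n - real \<alpha> - 3) / (2 * real n - real \<alpha> - 1))
      + 1 / 2 * (real n - real \<alpha>) * (real n - real \<alpha> - 1)
        * sqrt ((real n - 2) / (real n - 1))"
  shows "ABS G \<le> bound \<and>
    (ABS G = bound \<longleftrightarrow>
      digraph_iso (with_proj G)
        (with_proj (graph_join (edgeless_graph \<alpha>) (complete_graph (n - \<alpha>)))))"
proof -
  interpret pair_graph G by fact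
  obtain S where S: "independent_set G S" "card S = \<alpha>"
    using independence_number_witness[OF \<open>pair_graph G\<close>] assms(6) by blast
  define T where "T = pverts G - S"
  have V: "S \<union> T = pverts G" and disj: "S \<inter> T = {}"
    using S(1) by (auto simp: T_def independent_set_def)
  have fin: "finite S" "finite T"
    using finite_verts V by (metis finite_Un)+
  have n: "card S + card T = n"
    using card_Un_disjoint[OF fin disj] V assms(5) by simp
  \<comment> \<open>Since \<open>S\<close> is part of the vertex set,
    \<open>\<alpha> \<le> n\<close>, and the truncated difference agrees with the real one.\<close>
  then have card_T: "card T = n - \<alpha>" and real_T: "real (card T) = real n - real \<alpha>"
    using S(2) by auto
  let ?H = "split_graph S T"
  let ?J = "graph_join (edgeless_graph \<alpha>) (complete_graph (n - \<alpha>))"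
  have H: "pair_graph ?H"
    by (rule pair_graph_split_graph[OF fin])
  have sub: "parcs G \<subseteq> parcs ?H"
    unfolding T_def by (rule parcs_subset_split_graph[OF \<open>pair_graph G\<close> S(1)])
  have "real (m choose 2) = 1 / 2 * real m * (real m - 1)" for m
    by (induction m) (simp_all add: numeral_2_eq_2 field_simps)
  then have "real (card T choose 2) = 1 / 2 * (real n - real \<alpha>) * (real n - real \<alpha> - 1)"
    unfolding real_T[symmetric] .
  moreover have "edge_weight (real (card T + (n - 1)))
      = sqrt ((2 * real n - real \<alpha> - 3) / (2 * real n - real \<alpha> - 1))"
  proof -
    have "real (card T + (n - 1)) = 2 * real n - real \<alpha> - 1"
      using \<open>n > 0\<close> real_T by (simp add: of_nat_diff)
    moreover have "2 * real n - real \<alpha> - 1 - 2 = 2 * real n - real \<alpha> - 3"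
      by simp
    ultimately show ?thesis
      by (simp only: edge_weight_def)
  qed
  \<comment> \<open>The factor 2 of the degree sum 2(n - 1) cancels. For n = 1 both denominators are
    0 and both quotients are 0 by the convention of HOL.\<close>
  moreover have "edge_weight (real (2 * (n - 1))) = sqrt ((real n - 2) / (real n - 1))"
  proof -
    have "(2 * (real n - 1) - 2) / (2 * (real n - 1)) = (2 * (real n - 2)) / (2 * (real n - 1))"
      by (simp add: algebra_simps)
    also have "\<dots> = (real n - 2) / (real n - 1)"
      by (rule mult_divide_mult_cancel_left) simp
    finally show ?thesis
      using \<open>n > 0\<close> by (simp add: edge_weight_def of_nat_diff)
  qed
  ultimately have ABS_H: "ABS ?H = bound"
    by (simp only: ABS_split_graph[OF fin disj, unfolded n] S(2) of_nat_mult real_T bound_def)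
  have iso: "digraph_iso (with_proj ?H) (with_proj ?J)"
    using digraph_iso_split_graph_join[OF fin disj] S(2) card_T by simp
  have eq_imp: "parcs G = parcs ?H" if "ABS G = ABS ?H"
  proof -
    \<comment> \<open>Strict monotonicity requires degree sums above 2, which are available only
      from three vertices on.\<close>
    consider "n = 1" | "n = 2" | "n \<ge> 3"
      using \<open>n > 0\<close> by linarith
    then show ?thesis
    proof cases
      assume "n = 1"
      then obtain x where "S \<union> T = {x}"
        using V assms(5) by (metis card_1_singletonE)
      then have "parcs ?H = {}"
        by auto
      with sub show ?thesis by auto
    next
      assume "n = 2"
      then obtain x y where xy: "S \<union> T = {x, y}"
        using V assms(5) by (metis card_2_iff)
      obtain u v where uv: "(u, v) \<in> parcs G"
        using connected_has_arc assms(3-5) \<open>n = 2\<close> by fastforce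
      then have "(v, u) \<in> parcs G"
        by (rule arcs_symmetric)
      \<comment> \<open>On two vertices \<open>?H\<close> has no arcs beyond the two orientations of
        one edge, and connectedness has already put these into \<open>G\<close>.\<close>
      moreover have "parcs ?H \<subseteq> {(u, v), (v, u)}"
        using xy sub uv by auto
      ultimately show ?thesis
        using uv sub by auto
    next
      assume "n \<ge> 3"
      then show ?thesis
        using ABS_mono(2)[OF \<open>pair_graph G\<close> H sub that]
          degree_sum_split_graph_gt_2[OF fin disj] n by blast
    qed
  qed
  have "ABS G = ABS ?H \<longleftrightarrow> digraph_iso (with_proj G) (with_proj ?J)"
  proof
    assume "ABS G = ABS ?H"
    \<comment> \<open>Equal vertex and arc sets make the two records equal, so the isomorphism of
      \<open>?H\<close> with the join applies to \<open>G\<close> itself.\<close>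
    then have "G = ?H"
      using eq_imp V by (intro pair_pre_digraph.equality) auto
    with iso show "digraph_iso (with_proj G) (with_proj ?J)"
      by simp
  next
    assume "digraph_iso (with_proj G) (with_proj ?J)"
    then have "card (parcs G) = card (parcs ?H)"
      using iso by (simp add: card_parcs_digraph_iso)
    \<comment> \<open>An inclusion between finite sets of equal size is an equality.\<close>
    then have "parcs G = parcs ?H"
      using sub pair_graph.axioms(1)[OF H]
      by (intro card_subset_eq) (auto simp: pair_digraph_def pair_fin_digraph.pair_finite_arcs)
    then have "G = ?H"
      using V by (intro pair_pre_digraph.equality) auto
    then show "ABS G = ABS ?H"
      by simp
  qed
  with ABS_mono(1)[OF \<open>pair_graph G\<close> H sub] show ?thesis
    unfolding ABS_H by blast
qed

end
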